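(* Let $0<k\le n$ be integers and consider Moore's game $\mathrm{NIM}_{n,k}$. If $x=(x_1,\dots,x_n)\in\mathbb{Z}_+^n$ is a P-position of $\mathrm{NIM}_{n,k}$, then $\mathcal{R}(x)=2S(x)/(k+1)$, where $S(x)=\sum_{i=1}^n x_i$.
   Context: Moore's game $\mathrm{NIM}_{n,k}$ (for integers $0<k\le n$): positions are vectors $x=(x_1,\dots,x_n)\in\mathbb{Z}_+^n$ (sizes of $n$ piles of stones). Two players alternate; a move chooses any $\ell$ nonempty piles with $1\le \ell\le k$ and strictly reduces each of them (by arbitrary amounts). A player who cannot move loses (normal play). Remoteness function (Smith): for an acyclic game in which every position reaches only finitely many positions, $\mathcal{R}(x)=0$ if $x$ is terminal; otherwise, if some move $x\to y$ has $\mathcal{R}(y)$ even, $\mathcal{R}(x)=1+\min\{\mathcal{R}(y): x\to y,\ \mathcal{R}(y)\text{ even}\}$, and else $\mathcal{R}(x)=1+\max\{\mathcal{R}(y): x\to y\}$. P-positions are exactly the positions with $\mathcal{R}$ even (the player to move loses); N-positions are those with $\mathcal{R}$ odd. *)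

theory Defs
  imports Complex_Main
begin

text \<open>
  A game under the normal play convention is given by the function \<open>opts\<close>
  mapping a position to the set of positions reachable from it in one move.
\<close>

definition move_rel :: "('a \<Rightarrow> 'a set) \<Rightarrow> ('a \<times> 'a) set" where
  "move_rel opts = {(y, x). y \<in> opts x}"

text \<open>
  The recursion is well-founded for the games of interest (acyclic, with finitely many positions
  reachable from each position); \<open>remoteness_rec\<close> below is then the defining
  equation of Smith's remoteness function.
\<close>

definition remoteness :: "('a \<Rightarrow> 'a set) \<Rightarrow> 'a \<Rightarrow> nat" where
  "remoteness opts = wfrec (move_rel opts) (\<lambda>R x.
     if opts x = {} then 0
     else if \<exists>y\<in>opts x. even (R y) then 1 + Min {R y | y. y \<in> opts x \<and> even (R y)}
     else 1 + Max {R y | y. y \<in> opts x})"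

lemma remoteness_rec:
  assumes "wf (move_rel opts)"
  shows "remoteness opts x =
    (if opts x = {} then 0
     else if \<exists>y\<in>opts x. even (remoteness opts y)
       then 1 + Min {remoteness opts y | y. y \<in> opts x \<and> even (remoteness opts y)}
     else 1 + Max {remoteness opts y | y. y \<in> opts x})"
proof -
  define F where "F = (\<lambda>R x.
     if opts x = {} then 0
     else if \<exists>y\<in>opts x. even (R y) then 1 + Min {R y | y. y \<in> opts x \<and> even (R y)}
     else 1 + Max {R y | y. y \<in> opts x} :: nat)"
  have F: "F R z = F R' z" if eq: "\<And>y. y \<in> opts z \<Longrightarrow> R y = R' y" for R R' z
  proof -
    have "{R y | y. y \<in> opts z \<and> even (R y)} = {R' y | y. y \<in> opts z \<and> even (R' y)}"
      using eq by metis
    moreover have "{R y | y. y \<in> opts z} = {R' y | y. y \<in> opts z}"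
      using eq by metis
    moreover have "(\<exists>y\<in>opts z. even (R y)) \<longleftrightarrow> (\<exists>y\<in>opts z. even (R' y))"
      using eq by metis
    ultimately show ?thesis
      unfolding F_def by simp
  qed
  have "adm_wf (move_rel opts) F"
    unfolding adm_wf_def move_rel_def by (auto intro!: F)
  then have "wfrec (move_rel opts) F x = F (wfrec (move_rel opts) F) x"
    using wfrec_fixpoint[OF assms] by metis
  then show ?thesis
    unfolding remoteness_def F_def .
qed

text \<open>
  P-positions are the positions from which the player to move loses under optimal play, and
  N-positions those from which that player wins.
\<close>

inductive P_position :: "('a \<Rightarrow> 'a set) \<Rightarrow> 'a \<Rightarrow> bool"
  and N_position :: "('a \<Rightarrow> 'a set) \<Rightarrow> 'a \<Rightarrow> bool"
  for opts :: "'a \<Rightarrow> 'a set"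
where
  P_positionI: "(\<And>y. y \<in> opts x \<Longrightarrow> N_position opts y) \<Longrightarrow> P_position opts x"
| N_positionI: "y \<in> opts x \<Longrightarrow> P_position opts y \<Longrightarrow> N_position opts x"

lemma P_N_position_iff_remoteness:
  assumes wf: "wf (move_rel opts)" and fin: "\<And>x. finite (opts x)"
  shows "(P_position opts x \<longleftrightarrow> even (remoteness opts x)) \<and>
         (N_position opts x \<longleftrightarrow> odd (remoteness opts x))"
  using wf
proof (induction x rule: wf_induct_rule)
  case (less x)
  let ?R = "remoteness opts"
  have IH: "P_position opts y \<longleftrightarrow> even (?R y)" "N_position opts y \<longleftrightarrow> odd (?R y)"
    if "y \<in> opts x" for y
    using less that by (auto simp: move_rel_def)
  have P: "P_position opts x \<longleftrightarrow> (\<forall>y\<in>opts x. odd (?R y))"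
    using IH by (subst P_position.simps) blast
  have N: "N_position opts x \<longleftrightarrow> (\<exists>y\<in>opts x. even (?R y))"
    using IH by (subst N_position.simps) blast
  have R: "even (?R x) \<longleftrightarrow> (\<forall>y\<in>opts x. odd (?R y))"
  proof (cases "\<exists>y\<in>opts x. even (?R y)")
    case True
    let ?A = "{?R y | y. y \<in> opts x \<and> even (?R y)}"
    have "?A \<subseteq> ?R ` opts x" by blast
    then have "finite ?A" using fin[of x] by (meson finite_surj)
    then have "Min ?A \<in> ?A" using True by (intro Min_in) blast+
    then have "even (Min ?A)" by auto
    moreover have "?R x = 1 + Min ?A"
      using True by (subst remoteness_rec[OF wf]) auto
    ultimately show ?thesis using True by simp
  next
    case False
    let ?B = "{?R y | y. y \<in> opts x}"
    show ?thesis
    proof (cases "opts x = {}")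
      case True
      then show ?thesis by (subst remoteness_rec[OF wf]) simp
    next
      case ne: False
      have "?B = ?R ` opts x" by blast
      then have "finite ?B" using fin[of x] by simp
      then have "Max ?B \<in> ?B" using ne by (intro Max_in) blast+
      then have "odd (Max ?B)" using False by auto
      moreover have "?R x = 1 + Max ?B"
        using False ne by (subst remoteness_rec[OF wf]) simp
      ultimately show ?thesis using False by simp
    qed
  qed
  show ?case using P N R by blast
qed

text \<open>
  Positions of Moore's game are the lists of length \<open>n\<close>, with piles indexed from
  \<open>0\<close>. The set \<open>I\<close> below consists of the chosen piles; they are automatically
  nonempty as each of them is strictly reduced.
\<close>

definition moore_nim :: "nat \<Rightarrow> nat \<Rightarrow> nat list \<Rightarrow> nat list set" where
  "moore_nim n k x = {y. length x = n \<and> length y = n \<and>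
     (\<exists>I \<subseteq> {..<n}. 1 \<le> card I \<and> card I \<le> k \<and>
        (\<forall>i\<in>I. y ! i < x ! i) \<and> (\<forall>i\<in>{..<n} - I. y ! i = x ! i))}"

lemma moore_nim_le:
  assumes "y \<in> moore_nim n k x" "i < n"
  shows "y ! i \<le> x ! i"
proof -
  obtain I where "\<forall>i\<in>I. y ! i < x ! i" "\<forall>i\<in>{..<n} - I. y ! i = x ! i"
    using assms(1) unfolding moore_nim_def by blast
  then show ?thesis
    using assms(2) by (cases "i \<in> I") auto
qed

lemma moore_nim_sum_list_less:
  assumes "y \<in> moore_nim n k x"
  shows "sum_list y < sum_list x"
proof -
  obtain I where I: "I \<subseteq> {..<n}" "1 \<le> card I" "\<forall>i\<in>I. y ! i < x ! i"
    and len: "length x = n" "length y = n"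
    using assms unfolding moore_nim_def by blast
  obtain j where "j \<in> I" using I(2) by fastforce
  then have "j < n" "y ! j < x ! j" using I by auto
  then have "(\<Sum>i<n. y ! i) < (\<Sum>i<n. x ! i)"
    by (intro sum_strict_mono_ex1) (auto intro: moore_nim_le[OF assms])
  then show ?thesis
    using len by (simp add: sum_list_sum_nth lessThan_atLeast0)
qed

lemma wf_moore_nim: "wf (move_rel (moore_nim n k))"
  by (rule wf_subset[OF wf_measure[of sum_list]])
     (auto simp: move_rel_def dest: moore_nim_sum_list_less)

lemma finite_moore_nim: "finite (moore_nim n k x)"
proof (rule finite_subset)
  show "moore_nim n k x \<subseteq> {y. set y \<subseteq> {..sum_list x} \<and> length y = n}"
  proof
    fix y assume y: "y \<in> moore_nim n k x"
    then have "length y = n" by (simp add: moore_nim_def)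
    moreover have "a \<le> sum_list x" if "a \<in> set y" for a
      using member_le_sum_list[OF that] moore_nim_sum_list_less[OF y] by simp
    ultimately show "y \<in> {y. set y \<subseteq> {..sum_list x} \<and> length y = n}" by auto
  qed
  show "finite {y. set y \<subseteq> {..sum_list x} \<and> length y = n}"
    by (rule finite_lists_length_eq) simp
qed

end

(* Moore's P-positions x are those in which, for every j, the number of piles with binary digit 1
   at place j is divisible by k + 1; in particular S(x) is divisible by k + 1. So a round (two
   moves) between P-positions decreases S by at least k + 1, and it remains to see that the loser
   can enforce a decrease of exactly k + 1. To this end the loser takes one stone from a pile whose
   lowest digit 1 is at the lowest place j occurring in any pile. If the reply leads to a
   P-position z, then at the highest place where x and z differ exactly k + 1 digits turn from 1
   to 0; so the piles touched in the round are k + 1 in number and this place is j. The digits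
   below j vanish in x and are 1 in the first touched pile of z, so they are 1 in all the touched
   piles: the round took exactly one stone from each of k + 1 piles. *)

theory Submission
  imports Defs
begin

section \<open>Binary digits\<close>

text \<open>The quotients by \<open>2 ^ t\<close> have equal halves and differ in parity, and
  division by \<open>2 ^ t\<close> is monotone.\<close>

lemma less_nat_if_top_bit:
  fixes a b :: nat
  assumes "bit b t" "\<not> bit a t" "\<And>j. t < j \<Longrightarrow> bit a j \<longleftrightarrow> bit b j"
  shows "a < b"
proof -
  have "drop_bit (Suc t) a = drop_bit (Suc t) b"
    by (rule bit_eqI) (simp add: bit_drop_bit_eq assms(3))
  then have "drop_bit t a div 2 = drop_bit t b div 2"
    by (simp add: drop_bit_Suc drop_bit_half)
  moreover have "odd (drop_bit t b)" "even (drop_bit t a)"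
    using assms(1,2) by (simp_all add: bit_iff_odd_drop_bit)
  ultimately have "drop_bit t a < drop_bit t b"
    by presburger
  then have "a div 2 ^ t < b div 2 ^ t"
    by (simp add: drop_bit_eq_div)
  then show ?thesis
    by (meson div_le_mono leD leI)
qed

lemma bit_nat_less_bound:
  fixes a :: nat
  shows "bit a j \<Longrightarrow> j < a"
proof (rule ccontr)
  assume "bit a j" "\<not> j < a"
  then have "a < 2 ^ j" using less_exp[of j] by linarith
  then show False using \<open>bit a j\<close> by (simp add: bit_iff_odd)
qed

text \<open>Borrowing: the lowest digit 1, at place \<open>j\<close>, becomes 0 and the zeros below
  it become 1. The induction halves \<open>v\<close>, which for even positive \<open>v\<close> turns
  \<open>v - 1\<close> into \<open>v div 2 - 1\<close>.\<close>

lemma bit_nat_pred: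
  fixes v :: nat
  assumes "bit v j" "\<And>s. s < j \<Longrightarrow> \<not> bit v s"
  shows "bit (v - 1) s \<longleftrightarrow> s < j \<or> j < s \<and> bit v s"
  using assms
proof (induction j arbitrary: v s)
  case 0
  then have "odd v" by (simp add: bit_0)
  then have "(v - 1) div 2 = v div 2" "even (v - 1)" by presburger+
  then show ?case by (cases s) (auto simp: bit_Suc bit_0)
next
  case (Suc j)
  have "even v" using Suc.prems(2)[of 0] by (simp add: bit_0)
  moreover have "v \<noteq> 0" using Suc.prems(1) by (metis bit_0_eq bot_apply bot_bool_def)
  ultimately have *: "(v - 1) div 2 = v div 2 - 1" "odd (v - 1)" by presburger+
  have IH: "bit (v div 2 - 1) s \<longleftrightarrow> s < j \<or> j < s \<and> bit (v div 2) s" for s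
    using Suc.prems(1) Suc.prems(2)[of "Suc _"] by (intro Suc.IH) (auto simp: bit_Suc)
  show ?case
    using * IH by (cases s) (auto simp: bit_Suc bit_0)
qed

section \<open>Balanced families\<close>

text \<open>With \<open>m = k + 1\<close> and the pile sizes for \<open>f\<close> this is Moore's
  criterion; \<open>m = 2\<close> says that the nim-sum vanishes.\<close>

definition balanced :: "nat \<Rightarrow> 'i set \<Rightarrow> ('i \<Rightarrow> nat) \<Rightarrow> bool" where
  "balanced m A f \<longleftrightarrow> (\<forall>j. m dvd card {i \<in> A. bit (f i) j})"

text \<open>Expanding every term in binary and exchanging the sums leaves the digit counts as
  coefficients of the powers of 2.\<close>

lemma balanced_dvd_sum:
  assumes "balanced m A f" "finite A"
  shows "m dvd sum f A"
proof -
  \<comment> \<open>Larger than every \<open>f i\<close>, so that all digits 1 lie below place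
    \<open>N\<close>.\<close>
  define N where "N = Suc (sum f A)"
  have *: "f i = (\<Sum>j<N. of_bool (bit (f i) j) * 2 ^ j)" if "i \<in> A" for i
  proof -
    have "f i < N"
      using member_le_sum[OF that, of f] assms(2) by (simp add: N_def)
    then have "f i < 2 ^ N"
      using less_exp[of N] by linarith
    then have "f i = take_bit N (f i)"
      by (simp add: take_bit_nat_eq_self)
    then show ?thesis
      by (simp add: take_bit_sum push_bit_eq_mult lessThan_atLeast0)
  qed
  have "sum f A = (\<Sum>i\<in>A. \<Sum>j<N. of_bool (bit (f i) j) * 2 ^ j)"
    by (rule sum.cong[OF refl]) (rule *)
  also have "\<dots> = (\<Sum>j<N. \<Sum>i\<in>A. of_bool (bit (f i) j) * 2 ^ j)"
    by (rule sum.swap)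
  also have "\<dots> = (\<Sum>j<N. card {i \<in> A. bit (f i) j} * 2 ^ j)"
    using assms(2) by (simp add: sum_distrib_right[symmetric] Int_def)
  finally show ?thesis
    using assms(1) by (auto simp: balanced_def intro!: dvd_sum)
qed

text \<open>At the highest place where the families differ, \<open>g i \<le> f i\<close> only lets
  digits turn from 1 to 0. The number of those is a difference of two multiples of \<open>m\<close>,
  and it is positive.\<close>

lemma balanced_top_bit:
  assumes f: "balanced m A f" and g: "balanced m A g" and fin: "finite A"
    and le: "\<And>i. i \<in> A \<Longrightarrow> g i \<le> f i" and ne: "\<exists>i\<in>A. g i \<noteq> f i"
  obtains t where "m \<le> card {i \<in> A. bit (f i) t \<and> \<not> bit (g i) t}"
    and "\<And>i j. i \<in> A \<Longrightarrow> t < j \<Longrightarrow> bit (g i) j \<longleftrightarrow> bit (f i) j"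
proof -
  define J where "J = {j. \<exists>i\<in>A. bit (g i) j \<noteq> bit (f i) j}"
  have "J \<subseteq> {..sum f A}"
  proof
    fix j assume "j \<in> J"
    then obtain i where i: "i \<in> A" "bit (g i) j \<noteq> bit (f i) j" by (auto simp: J_def)
    then have "j < g i \<or> j < f i" using bit_nat_less_bound by blast
    then have "j < f i" using le[OF i(1)] by auto
    then show "j \<in> {..sum f A}" using member_le_sum[OF i(1), of f] fin by simp
  qed
  then have finJ: "finite J" by (rule finite_subset) simp
  have "J \<noteq> {}" using ne by (auto simp: J_def bit_eq_iff)
  define t where "t = Max J"
  have tJ: "t \<in> J" using Max_in[OF finJ \<open>J \<noteq> {}\<close>] by (simp add: t_def)
  have above: "bit (g i) j \<longleftrightarrow> bit (f i) j" if "i \<in> A" "t < j" for i j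
    using Max_ge[OF finJ, of j] that by (fastforce simp: t_def J_def)
  have down: "bit (f i) t" if "i \<in> A" "bit (g i) t" for i
    using less_nat_if_top_bit[of "g i" t "f i"] above le[OF that(1)] that by (meson leD)
  let ?F = "{i \<in> A. bit (f i) t}" and ?G = "{i \<in> A. bit (g i) t}"
  let ?D = "{i \<in> A. bit (f i) t \<and> \<not> bit (g i) t}"
  have "?D = ?F - ?G" by auto
  moreover have "?G \<subseteq> ?F" using down by auto
  ultimately have "card ?D = card ?F - card ?G"
    using fin by (simp add: card_Diff_subset)
  then have "m dvd card ?D"
    using f g by (simp add: balanced_def)
  moreover have "?D \<noteq> {}" using tJ down by (auto simp: J_def)
  then have "card ?D > 0" using fin by (simp add: card_gt_0_iff)
  ultimately have "m \<le> card ?D" by (rule dvd_imp_le)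
  then show thesis using above that by blast
qed

text \<open>
  The winner's move fixes the digits from the top down. \<open>F\<close> is the set of piles that
  have already lost a digit 1 at a place \<open>\<ge> b\<close>, so their lower digits are free.
\<close>

lemma balance_low_bits:
  fixes f :: "'i \<Rightarrow> nat"
  assumes "finite A" "F \<subseteq> A" "card F \<le> k"
  shows "\<exists>g T. F \<subseteq> T \<and> T \<subseteq> A \<and> card T \<le> k \<and> (\<forall>i\<in>A - T. g i = f i) \<and>
    (\<forall>i\<in>T - F. g i < f i) \<and> (\<forall>i\<in>A. \<forall>j\<ge>b. bit (g i) j = bit (f i) j) \<and>
    (\<forall>j<b. k + 1 dvd card {i \<in> A. bit (g i) j})"
  using assms(2,3)
proof (induction b arbitrary: f F)
  case 0
  then show ?case by (intro exI[of _ f] exI[of _ F]) auto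
next
  case (Suc b)
  have finF: "finite F" using Suc.prems(1) assms(1) finite_subset by blast
  define U where "U = {i \<in> A - F. bit (f i) b}"
  have finU: "finite U" using assms(1) by (simp add: U_def)
  \<comment> \<open>The surplus of digits 1 at place \<open>b\<close> among the piles that are not
    yet free.\<close>
  define c where "c = card U mod (k + 1)"
  have cU: "c \<le> card U" by (simp add: c_def)
  have ck: "c \<le> k" using mod_less_divisor[of "k + 1" "card U"] by (simp add: c_def del: mod_less_divisor)
  have dvd: "k + 1 dvd card U - c" by (simp add: c_def)
  \<comment> \<open>The piles in \<open>V\<close> lose their digit at \<open>b\<close> and become
    free; of the free piles, exactly those in \<open>W\<close> get digit 1 at \<open>b\<close>. If
    \<open>c\<close> more piles may be touched, \<open>V\<close> removes the surplus. Otherwise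
    \<open>F\<close> has at least \<open>k + 1 - c\<close> piles, enough to fill the count up to the
    next multiple of \<open>k + 1\<close>.\<close>
  have "\<exists>V W. V \<subseteq> U \<and> W \<subseteq> F \<and> card (F \<union> V) \<le> k \<and> k + 1 dvd card ((U - V) \<union> W)"
  proof (cases "c = 0 \<or> card F + c \<le> k")
    case True
    obtain V where V: "V \<subseteq> U" "card V = c"
      using obtain_subset_with_card_n[OF cU] by blast
    have "finite V" using V finU finite_subset by blast
    then have "card (U - V) = card U - c" using V by (simp add: card_Diff_subset)
    moreover have "card (F \<union> V) \<le> k"
      using True V Suc.prems(2) card_Un_le[of F V] by auto
    ultimately show ?thesis using V dvd by (intro exI[of _ V] exI[of _ "{}"]) simp
  next
    case False
    then have "k + 1 - c \<le> card F" by arith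
    then obtain W where W: "W \<subseteq> F" "card W = k + 1 - c"
      by (rule obtain_subset_with_card_n)
    have "card (U \<union> W) = card U + card W"
      using W(1) finF finU finite_subset by (intro card_Un_disjoint) (auto simp: U_def)
    also have "\<dots> = (card U - c) + (k + 1)" using W(2) cU ck by simp
    finally have "k + 1 dvd card (U \<union> W)" using dvd by (simp only: dvd_add dvd_refl)
    then show ?thesis using W Suc.prems(2) by (intro exI[of _ "{}"] exI[of _ W]) simp
  qed
  then obtain V W where VW: "V \<subseteq> U" "W \<subseteq> F" "card (F \<union> V) \<le> k" "k + 1 dvd card ((U - V) \<union> W)"
    by blast
  define f1 where
    "f1 i = (if i \<in> W then set_bit b (f i) else if i \<in> F \<union> V then unset_bit b (f i) else f i)" for i
  have f1: "bit (f1 i) j \<longleftrightarrow> (if j = b \<and> i \<in> F \<union> V then i \<in> W else bit (f i) j)" for i j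
    using VW(2) by (auto simp: f1_def bit_set_bit_iff bit_unset_bit_iff)
  have "F \<union> V \<subseteq> A" using Suc.prems(1) VW(1) by (auto simp: U_def)
  then obtain g T where gT: "F \<union> V \<subseteq> T" "T \<subseteq> A" "card T \<le> k"
    "\<forall>i\<in>A - T. g i = f1 i" "\<forall>i\<in>T - (F \<union> V). g i < f1 i"
    "\<forall>i\<in>A. \<forall>j\<ge>b. bit (g i) j = bit (f1 i) j" "\<forall>j<b. k + 1 dvd card {i \<in> A. bit (g i) j}"
    using Suc.IH[of "F \<union> V" f1] VW(3) by blast
  show ?case
  proof (intro exI[of _ g] exI[of _ T] conjI ballI allI impI)
    show "F \<subseteq> T" "T \<subseteq> A" "card T \<le> k" using gT by auto
  next
    fix i assume "i \<in> A - T"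
    then show "g i = f i" using gT(1,4) VW(2) by (auto simp: f1_def)
  next
    fix i assume i: "i \<in> T - F"
    show "g i < f i"
    proof (cases "i \<in> V")
      case True
      then have iA: "i \<in> A" "bit (f i) b" "i \<notin> W" using VW(1,2) i by (auto simp: U_def)
      \<comment> \<open>The highest digit in which a pile of \<open>V\<close> changes is the 1 lost
        at \<open>b\<close>, so whatever happens below, the pile shrinks.\<close>
      show ?thesis
        by (rule less_nat_if_top_bit[of _ b]) (use iA gT(6) f1 True in auto)
    next
      case False
      then have "f1 i = f i" "g i < f1 i" using gT(5) i VW(2) by (auto simp: f1_def)
      then show ?thesis by simp
    qed
  next
    fix i j assume "i \<in> A" "Suc b \<le> j"
    then show "bit (g i) j = bit (f i) j" using gT(6) f1 by simp
  next
    fix j assume "j < Suc b"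
    moreover have "k + 1 dvd card {i \<in> A. bit (g i) b}"
    proof -
      have "{i \<in> A. bit (g i) b} = {i \<in> A. bit (f1 i) b}" using gT(6) by auto
      also have "\<dots> = (U - V) \<union> W"
        using VW(1,2) Suc.prems(1) by (auto simp: f1 U_def)
      finally show ?thesis using VW(4) by simp
    qed
    ultimately show "k + 1 dvd card {i \<in> A. bit (g i) j}"
      using gT(7) by (auto simp: less_Suc_eq)
  qed
qed

text \<open>The digit-fixing procedure is started with no free piles, at a place above all digits.
  Some pile must change because \<open>f\<close> itself is not balanced.\<close>

lemma obtain_balanced:
  fixes f :: "'i \<Rightarrow> nat"
  assumes "finite A" "\<not> balanced (k + 1) A f"
  obtains g T where "T \<subseteq> A" "T \<noteq> {}" "card T \<le> k" "\<And>i. i \<in> T \<Longrightarrow> g i < f i"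
    "\<And>i. i \<in> A - T \<Longrightarrow> g i = f i" "balanced (k + 1) A g"
proof -
  define b where "b = sum f A"
  have high: "\<not> bit (f i) j" if "i \<in> A" "b \<le> j" for i j
    using bit_nat_less_bound[of "f i" j] member_le_sum[OF that(1), of f] that assms(1)
    by (auto simp: b_def)
  obtain g T where gT: "T \<subseteq> A" "card T \<le> k" "\<forall>i\<in>A - T. g i = f i" "\<forall>i\<in>T. g i < f i"
    "\<forall>i\<in>A. \<forall>j\<ge>b. bit (g i) j = bit (f i) j" "\<forall>j<b. k + 1 dvd card {i \<in> A. bit (g i) j}"
    using balance_low_bits[OF assms(1), of "{}" k f b] by auto
  have bal: "balanced (k + 1) A g"
    unfolding balanced_def
  proof
    fix j
    show "k + 1 dvd card {i \<in> A. bit (g i) j}"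
    proof (cases "j < b")
      case False
      then have "{i \<in> A. bit (g i) j} = {}" using gT(5) high by auto
      then show ?thesis by (metis card.empty dvd_0_right)
    qed (use gT(6) in blast)
  qed
  have "T \<noteq> {}"
  proof
    assume "T = {}"
    then have "{i \<in> A. bit (g i) j} = {i \<in> A. bit (f i) j}" for j using gT(3) by auto
    then show False using bal assms(2) by (simp add: balanced_def)
  qed
  then show thesis using that[of T g] gT bal by blast
qed

section \<open>The P-positions of Moore's game\<close>

text \<open>Passing between balanced positions changes at least \<open>k + 1\<close> piles, and a
  move changes at most \<open>k\<close>.\<close>

lemma moore_nim_balanced_unbalanced:
  assumes "y \<in> moore_nim n k x" "balanced (k + 1) {..<n} ((!) x)"
  shows "\<not> balanced (k + 1) {..<n} ((!) y)"
proof
  assume y: "balanced (k + 1) {..<n} ((!) y)"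
  obtain I where I: "I \<subseteq> {..<n}" "1 \<le> card I" "card I \<le> k" "\<forall>i\<in>I. y ! i < x ! i"
    "\<forall>i\<in>{..<n} - I. y ! i = x ! i"
    using assms(1) unfolding moore_nim_def by blast
  have "I \<noteq> {}" using I(2) by auto
  then have "\<exists>i\<in>{..<n}. y ! i \<noteq> x ! i" using I(1,4) by fastforce
  then obtain t where t: "k + 1 \<le> card {i \<in> {..<n}. bit (x ! i) t \<and> \<not> bit (y ! i) t}"
    using balanced_top_bit[OF assms(2) y] moore_nim_le[OF assms(1)] by (metis finite_lessThan lessThan_iff)
  have "{i \<in> {..<n}. bit (x ! i) t \<and> \<not> bit (y ! i) t} \<subseteq> I"
    using I(5) by force
  then have "card {i \<in> {..<n}. bit (x ! i) t \<and> \<not> bit (y ! i) t} \<le> card I"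
    using I(1) by (meson card_mono finite_lessThan finite_subset)
  then show False using t I(3) by simp
qed

lemma moore_nim_unbalanced_balanced:
  assumes "length x = n" "\<not> balanced (k + 1) {..<n} ((!) x)"
  shows "\<exists>y\<in>moore_nim n k x. balanced (k + 1) {..<n} ((!) y)"
proof -
  obtain g T where gT: "T \<subseteq> {..<n}" "T \<noteq> {}" "card T \<le> k" "\<And>i. i \<in> T \<Longrightarrow> g i < x ! i"
    "\<And>i. i \<in> {..<n} - T \<Longrightarrow> g i = x ! i" "balanced (k + 1) {..<n} g"
    by (rule obtain_balanced[OF finite_lessThan assms(2)]) blast
  define y where "y = map g [0..<n]"
  have y: "y ! i = g i" if "i < n" for i using that by (simp add: y_def)
  have "{i \<in> {..<n}. bit (y ! i) j} = {i \<in> {..<n}. bit (g i) j}" for j using y by auto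
  then have "balanced (k + 1) {..<n} ((!) y)"
    using gT(6) by (simp add: balanced_def)
  moreover have "1 \<le> card T"
    using gT(1,2) by (metis One_nat_def Suc_leI card_gt_0_iff finite_lessThan finite_subset)
  then have "y \<in> moore_nim n k x"
    using gT(1,3,4,5) assms(1) y unfolding moore_nim_def
    by (auto intro!: exI[of _ T] simp: y_def)
  ultimately show ?thesis by blast
qed

text \<open>Moore's theorem: every move destroys balance and some move restores it, so balanced
  positions obey the recursion that determines the P-positions.\<close>

lemma P_position_moore_nim_iff:
  assumes "length x = n"
  shows "P_position (moore_nim n k) x \<longleftrightarrow> balanced (k + 1) {..<n} ((!) x)"
  using assms
proof (induction "sum_list x" arbitrary: x rule: less_induct)
  case less
  let ?M = "moore_nim n k"
  have IH: "P_position ?M y \<longleftrightarrow> balanced (k + 1) {..<n} ((!) y)" if "y \<in> ?M x" for y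
    using less that moore_nim_sum_list_less[OF that] by (auto simp: moore_nim_def)
  have PN: "P_position ?M y \<longleftrightarrow> \<not> N_position ?M y" for y
    using P_N_position_iff_remoteness[OF wf_moore_nim finite_moore_nim] by blast
  have "P_position ?M x \<longleftrightarrow> (\<forall>y\<in>?M x. \<not> P_position ?M y)"
    using PN by (subst P_position.simps) blast
  also have "\<dots> \<longleftrightarrow> (\<forall>y\<in>?M x. \<not> balanced (k + 1) {..<n} ((!) y))"
    using IH by blast
  also have "\<dots> \<longleftrightarrow> balanced (k + 1) {..<n} ((!) x)"
    using moore_nim_balanced_unbalanced moore_nim_unbalanced_balanced[OF less.prems] by blast
  finally show ?case .
qed

section \<open>Remoteness\<close>

text \<open>The loser's delaying move. The conclusion covers all balanced replies \<open>z\<close>,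
  as the winner chooses among them.\<close>

lemma moore_nim_slow_move:
  assumes "0 < k" and len: "length x = n" and bal: "balanced (k + 1) {..<n} ((!) x)"
    and nz: "\<exists>i<n. x ! i \<noteq> 0"
  obtains y where "y \<in> moore_nim n k x"
    and "\<And>z. z \<in> moore_nim n k y \<Longrightarrow> balanced (k + 1) {..<n} ((!) z) \<Longrightarrow>
          (\<Sum>i<n. x ! i) = (\<Sum>i<n. z ! i) + (k + 1)"
proof -
  define j where "j = (LEAST j. \<exists>i<n. bit (x ! i) j)"
  have "\<exists>j. \<exists>i<n. bit (x ! i) j"
    using nz by (metis bit_eq_iff bit_0_eq bot_apply bot_bool_def)
  then have "\<exists>i<n. bit (x ! i) j" unfolding j_def by (rule LeastI_ex)
  then obtain i where i: "i < n" "bit (x ! i) j" by blast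
  have low: "\<not> bit (x ! l) s" if "l < n" "s < j" for l s
    using that not_less_Least unfolding j_def by blast
  have pred: "bit (x ! l - 1) s \<longleftrightarrow> s < j \<or> j < s \<and> bit (x ! l) s" if "l < n" "bit (x ! l) j" for l s
    using bit_nat_pred[of "x ! l" j] that low by blast
  have xi: "0 < x ! i" using bit_nat_less_bound[OF i(2)] by simp
  define y where "y = x[i := x ! i - 1]"
  have y: "y ! l = (if l = i then x ! i - 1 else x ! l)" if "l < n" for l
    using that len by (simp add: y_def nth_list_update)
  have yM: "y \<in> moore_nim n k x"
    unfolding moore_nim_def using i xi len y assms(1)
    by (auto intro!: exI[of _ "{i}"] simp: y_def)
  have "(\<Sum>i<n. x ! i) = (\<Sum>i<n. z ! i) + (k + 1)"
    if z: "z \<in> moore_nim n k y" "balanced (k + 1) {..<n} ((!) z)" for z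
  proof -
    obtain I where I: "I \<subseteq> {..<n}" "card I \<le> k" "\<forall>l\<in>{..<n} - I. z ! l = y ! l"
      using z(1) unfolding moore_nim_def by blast
    have le: "z ! l \<le> x ! l" if "l \<in> {..<n}" for l
      using moore_nim_le[OF z(1)] moore_nim_le[OF yM] that by (meson lessThan_iff order_trans)
    have "z ! i \<noteq> x ! i"
      using moore_nim_le[OF z(1) i(1)] y[OF i(1)] xi by simp
    then have "\<exists>l\<in>{..<n}. z ! l \<noteq> x ! l" using i by blast
    then obtain t where t: "k + 1 \<le> card {l \<in> {..<n}. bit (x ! l) t \<and> \<not> bit (z ! l) t}"
      "\<And>l s. l \<in> {..<n} \<Longrightarrow> t < s \<Longrightarrow> bit (z ! l) s \<longleftrightarrow> bit (x ! l) s"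
      using balanced_top_bit[OF bal z(2) _ le] by auto
    define D where "D = {l \<in> {..<n}. bit (x ! l) t \<and> \<not> bit (z ! l) t}"
    have finI: "finite I" using I(1) finite_subset by blast
    \<comment> \<open>The round touches only \<open>i\<close> and the piles of \<open>I\<close>, at
      most \<open>k + 1\<close> in all, while \<open>D\<close> has at least \<open>k + 1\<close>
      elements; hence equality.\<close>
    have "D \<subseteq> insert i I"
    proof
      fix l assume "l \<in> D"
      then have "l < n" "z ! l \<noteq> x ! l" by (auto simp: D_def)
      then show "l \<in> insert i I" using I(3) y[of l] by (cases "l \<in> I") (auto split: if_splits)
    qed
    moreover have "card (insert i I) \<le> k + 1" using I(2) card_insert_le_m1[of "k + 1" I i] by simp
    ultimately have D: "D = insert i I"
      using t(1) finI by (intro card_seteq) (auto simp: D_def)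
    then have cardD: "card D = k + 1"
      using t(1) \<open>card (insert i I) \<le> k + 1\<close> by (simp add: D_def)
    \<comment> \<open>Otherwise \<open>D = I\<close> would have at most \<open>k\<close> elements.
      So pile \<open>i\<close> loses just the one stone taken by the loser.\<close>
    then have "i \<notin> I" using D I(2) by (auto simp: insert_absorb)
    then have zi: "z ! i = x ! i - 1" using I(3) i(1) y by auto
    have "i \<in> D" using D by simp
    then have "bit (x ! i) t" "\<not> bit (x ! i - 1) t" using zi by (simp_all add: D_def)
    \<comment> \<open>Taking one stone from pile \<open>i\<close> turns no digit but the one at
      \<open>j\<close> from 1 to 0.\<close>
    then have "t = j"
      using pred[OF i, of t] low[OF i(1), of t] by (meson linorder_neqE_nat)
    \<comment> \<open>All digits of \<open>x\<close> at \<open>s\<close> vanish, so a 1 of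
      \<open>z\<close> there lies in a touched pile. Pile \<open>i\<close> has one by borrowing, and
      the count is a multiple of \<open>k + 1 = card D\<close>; hence every touched pile has
      one.\<close>
    have below: "bit (z ! l) s" if "s < j" "l \<in> D" for l s
    proof -
      let ?E = "{l \<in> {..<n}. bit (z ! l) s}"
      have "?E \<subseteq> D"
        using low that(1) I(3) y D by (force split: if_splits)
      moreover have "i \<in> ?E" using zi pred[OF i] i(1) that(1) by simp
      then have "0 < card ?E" by (auto simp: card_gt_0_iff)
      then have "card D \<le> card ?E"
        using z(2) cardD by (auto simp: balanced_def intro!: dvd_imp_le)
      ultimately have "?E = D" by (intro card_seteq) (auto simp: D_def)
      then show ?thesis using that(2) by blast
    qed
    have "x ! l = z ! l + of_bool (l \<in> D)" if l: "l < n" for l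
    proof (cases "l \<in> D")
      case True
      then have lj: "bit (x ! l) j" "\<not> bit (z ! l) j" using \<open>t = j\<close> by (auto simp: D_def)
      \<comment> \<open>Both numbers have ones below \<open>j\<close>, 0 at \<open>j\<close> and the
        digits of \<open>x ! l\<close> above.\<close>
      have "bit (z ! l) s \<longleftrightarrow> bit (x ! l - 1) s" for s
        using pred[OF l lj(1), of s] below[OF _ True, of s] t(2)[of l s] l lj(2) \<open>t = j\<close>
        by (cases s j rule: linorder_cases) auto
      then have "z ! l = x ! l - 1" by (simp add: bit_eq_iff)
      then show ?thesis using True bit_nat_less_bound[OF lj(1)] by simp
    next
      case False
      then show ?thesis using D I(3) y l by auto
    qed
    then have "(\<Sum>l<n. x ! l) = (\<Sum>l<n. z ! l + of_bool (l \<in> D))" by simp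
    also have "\<dots> = (\<Sum>l<n. z ! l) + card ({..<n} \<inter> D)"
      by (simp add: sum.distrib sum_of_bool_eq)
    also have "{..<n} \<inter> D = D" by (auto simp: D_def)
    finally show ?thesis using cardD by simp
  qed
  then show thesis using that yM by blast
qed

text \<open>Induction over rounds of two moves. All options of \<open>x\<close> are N-positions, so
  its remoteness is one more than the maximum over them; \<open>upper\<close> bounds this maximum
  and the delaying move attains it. The product form stays within the natural numbers.\<close>

lemma remoteness_P_position_moore_nim:
  assumes "0 < k" "length x = n" "P_position (moore_nim n k) x"
  shows "(k + 1) * remoteness (moore_nim n k) x = 2 * (\<Sum>i<n. x ! i)"
  using assms(2,3)
proof (induction "sum_list x" arbitrary: x rule: less_induct)
  case less
  let ?M = "moore_nim n k"
  let ?R = "remoteness ?M"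
  let ?S = "\<lambda>x. \<Sum>i<n. x ! i"
  note rec = remoteness_rec[OF wf_moore_nim]
  have PR: "P_position ?M y \<longleftrightarrow> even (?R y)" for y
    using P_N_position_iff_remoteness[OF wf_moore_nim finite_moore_nim] by blast
  have len: "length y = n" if "y \<in> ?M u" for y u
    using that by (simp add: moore_nim_def)
  have S: "sum_list y = ?S y" if "length y = n" for y :: "nat list"
    using that by (simp add: sum_list_sum_nth lessThan_atLeast0)
  have dvdS: "k + 1 dvd ?S y" if "length y = n" "P_position ?M y" for y
    using balanced_dvd_sum P_position_moore_nim_iff that by blast
  have odd: "odd (?R y)" if "y \<in> ?M x" for y
    using less.prems that moore_nim_balanced_unbalanced[OF that]
      P_position_moore_nim_iff[of x n k] P_position_moore_nim_iff[OF len[OF that], of k] PR by blast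
  show ?case
  proof (cases "\<exists>i<n. x ! i \<noteq> 0")
    case False
    then have "?S x = 0" by simp
    moreover have "?M x = {}"
    proof -
      have False if "y \<in> ?M x" for y
        using moore_nim_sum_list_less[OF that] S[OF less.prems(1)] \<open>?S x = 0\<close> by simp
      then show ?thesis by blast
    qed
    then have "?R x = 0" by (subst rec) simp
    ultimately show ?thesis by simp
  next
    case True
    define B where "B = {?R y | y. y \<in> ?M x}"
    have B: "B = ?R ` ?M x" by (auto simp: B_def)
    \<comment> \<open>The winner moves to a P-position of least remoteness.\<close>
    have reply: "\<exists>z\<in>?M y. P_position ?M z \<and> ?R y = 1 + ?R z \<and>
        (\<forall>z'\<in>?M y. P_position ?M z' \<longrightarrow> ?R z \<le> ?R z')" if y: "y \<in> ?M x" for y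
    proof -
      let ?A = "{?R z | z. z \<in> ?M y \<and> even (?R z)}"
      have "N_position ?M y"
        using odd[OF y] P_N_position_iff_remoteness[OF wf_moore_nim finite_moore_nim] by blast
      then have ex: "\<exists>z\<in>?M y. even (?R z)"
        using PR by (subst (asm) N_position.simps) blast
      have "?A \<subseteq> ?R ` ?M y" by blast
      then have fin: "finite ?A" using finite_moore_nim by (meson finite_surj)
      have "Min ?A \<in> ?A" using ex by (intro Min_in[OF fin]) blast
      then obtain z where z: "z \<in> ?M y" "even (?R z)" "Min ?A = ?R z" by auto
      have "?R y = 1 + Min ?A" using ex by (subst rec) auto
      moreover have "Min ?A \<le> ?R z'" if "z' \<in> ?M y" "even (?R z')" for z'
        using that by (intro Min_le[OF fin]) blast
      ultimately show ?thesis using z PR by auto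
    qed
    have IH: "(k + 1) * ?R z = 2 * ?S z" if "y \<in> ?M x" "z \<in> ?M y" "P_position ?M z" for y z
      using less.hyps[of z] that len moore_nim_sum_list_less[OF that(1)]
        moore_nim_sum_list_less[OF that(2)] by simp
    \<comment> \<open>Both \<open>?S x\<close> and \<open>?S z\<close> are multiples of
      \<open>k + 1\<close>, so the round costs at least \<open>k + 1\<close> stones, while it adds 2
      to the remoteness.\<close>
    have upper: "(k + 1) * (?R y + 1) \<le> 2 * ?S x" if y: "y \<in> ?M x" for y
    proof -
      obtain z where z: "z \<in> ?M y" "P_position ?M z" "?R y = 1 + ?R z" using reply[OF y] by blast
      have "?S z < ?S x"
        using moore_nim_sum_list_less[OF y] moore_nim_sum_list_less[OF z(1)]
          S[OF less.prems(1)] S[OF len[OF z(1)]] by simp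
      moreover obtain p where p: "?S x = (k + 1) * p" using dvdS[OF less.prems] by blast
      moreover obtain q where q: "?S z = (k + 1) * q" using dvdS[OF len[OF z(1)] z(2)] by blast
      ultimately have "q < p" by (metis nat_mult_less_cancel_disj)
      then have "(k + 1) * (q + 1) \<le> (k + 1) * p" by (intro mult_le_mono2) simp
      then have "?S z + (k + 1) \<le> ?S x" using p q by simp
      moreover have "(k + 1) * (?R y + 1) = 2 * ?S z + 2 * (k + 1)"
        using IH[OF y z(1,2)] z(3) by (simp add: algebra_simps)
      ultimately show ?thesis by simp
    qed
    \<comment> \<open>For the delaying option the cost is exactly \<open>k + 1\<close> whatever the
      balanced reply, in particular for the fastest one.\<close>
    obtain y where y: "y \<in> ?M x" and slow:
      "\<And>z. z \<in> ?M y \<Longrightarrow> balanced (k + 1) {..<n} ((!) z) \<Longrightarrow> ?S x = ?S z + (k + 1)"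
      using moore_nim_slow_move[OF assms(1) less.prems(1) _ True]
        P_position_moore_nim_iff[OF less.prems(1)] less.prems(2) by blast
    obtain z where z: "z \<in> ?M y" "P_position ?M z" "?R y = 1 + ?R z" using reply[OF y] by blast
    have "?S x = ?S z + (k + 1)"
      using slow[OF z(1)] P_position_moore_nim_iff[OF len[OF z(1)]] z(2) by blast
    then have max: "(k + 1) * (?R y + 1) = 2 * ?S x"
      using IH[OF y z(1,2)] z(3) by (simp add: algebra_simps)
    have "Max B = ?R y"
    proof (rule Max_eqI)
      show "finite B" using finite_moore_nim by (simp add: B)
      show "?R y \<in> B" using y by (simp add: B)
      fix r assume "r \<in> B"
      then obtain y' where y': "y' \<in> ?M x" "r = ?R y'" by (auto simp: B)
      then have "(k + 1) * (r + 1) \<le> (k + 1) * (?R y + 1)" using upper max by simp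
      then show "r \<le> ?R y" by (simp only: mult_le_cancel1) simp
    qed
    moreover have "?R x = 1 + Max B"
      using y odd unfolding B_def by (subst rec) auto
    ultimately show ?thesis using max by (simp add: add.commute)
  qed
qed

theorem mainTheorem1:
  fixes n k :: nat and x :: "nat list"
  assumes "0 < k" and "k \<le> n"
    and "length x = n"
    and "P_position (moore_nim n k) x"
  shows "real (remoteness (moore_nim n k) x) = 2 * real (\<Sum>i<n. x ! i) / (real k + 1)"
proof -
  have "real ((k + 1) * remoteness (moore_nim n k) x) = real (2 * (\<Sum>i<n. x ! i))"
    using remoteness_P_position_moore_nim[OF assms(1,3,4)] by (rule arg_cong)
  then have "(real k + 1) * real (remoteness (moore_nim n k) x) = 2 * real (\<Sum>i<n. x ! i)"
    by (simp only: of_nat_mult of_nat_add of_nat_1 of_nat_numeral)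
  then show ?thesis
    by (simp add: field_simps)
qed

end
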